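(* Let $n\ge 2$ be an integer, $\lambda>\frac{1}{n-1}$, $\mu<0$, and let $f\in C^1([0,\infty))\cap C^2(0,\infty)$ be the unique solution of the initial value problem $$f_{rr}(r)+\frac{n-1}{r}\,(1+f_r(r)^2)\,f_r(r)-\frac{1}{\lambda}\cdot\frac{(1+f_r(r)^2)^2}{r f_r(r)-f(r)}=0\quad\text{for all } r>0,\qquad f(0)=\mu,\quad f_r(0)=0,$$ which satisfies $r f_r(r)>f(r)$ for all $r\ge 0$. Then $$f_{rr}(r)>0\quad\text{for all } r>0\qquad\text{and}\qquad \lim_{r\to\infty}f(r)=\infty.$$
   Context: Here $f$ is a real-valued function of one real variable $r\ge 0$; $f_r$ and $f_{rr}$ denote its first and second derivatives, the derivative at $r=0$ being one-sided. Existence and uniqueness of such a solution $f$ is a separate result of the paper. *)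

theory Defs
  imports Complex_Main
begin

end

theory Submission
  imports Defs
begin

text \<open>
  Write \<open>p\<close> for the derivative of \<open>f\<close>, \<open>w = r p - f > 0\<close> and \<open>c = lam (n - 1) > 0\<close>. The
  equation says that \<open>p'\<close> is a positive multiple of \<open>H = r (1 + p\<^sup>2) - c p w\<close>, so convexity of
  \<open>f\<close> amounts to \<open>H > 0\<close>. Since \<open>w' = r p'\<close>, every term of \<open>H'\<close> except \<open>1 + p\<^sup>2\<close> carries a
  factor \<open>p'\<close>. Hence \<open>H' = 1 + p\<^sup>2 > 0\<close> wherever \<open>H\<close> vanishes, and \<open>H\<close> can cross zero only
  upwards (\<open>upcrossing_stays_positive\<close>).

  If \<open>H (r) \<le> 0\<close> for some \<open>r > 0\<close>, then \<open>H < 0\<close>, that is \<open>p' < 0\<close>, on the whole of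
  \<open>(0, r)\<close>. As \<open>p\<close> starts at \<open>0\<close>, it is negative there; but \<open>p < 0\<close> makes both terms of \<open>H\<close>
  positive, a contradiction (\<open>positive_of_upcrossing_sign_condition\<close>). So \<open>f\<close> is strictly
  convex, \<open>p (1) > 0\<close>, and \<open>f\<close> lies above its tangent at \<open>1\<close>, an increasing affine function.
\<close>

lemma upcrossing_stays_positive:
  fixes g g' :: "real \<Rightarrow> real"
  assumes der: "\<And>x. s \<le> x \<Longrightarrow> (g has_real_derivative g' x) (at x)"
    and up: "\<And>x. s \<le> x \<Longrightarrow> g x = 0 \<Longrightarrow> g' x > 0"
    and start: "g s \<ge> 0" and st: "s < t"
  shows "g t > 0"
proof (rule ccontr)
  assume "\<not> g t > 0"
  hence gt: "g t \<le> 0" by simp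
  obtain u where u: "s \<le> u" "u < t" "g u > 0"
  proof (cases "g s = 0")
    case True
    then obtain d where d: "d > 0" "\<And>h. h > 0 \<Longrightarrow> h < d \<Longrightarrow> g s < g (s + h)"
      using DERIV_pos_inc_right[OF der[of s] up[of s]] by auto
    define h where "h = min (d / 2) ((t - s) / 2)"
    have "h > 0" "h < d" "s + h < t" using d(1) st by (auto simp: h_def min_def field_simps)
    then show ?thesis using that[of "s + h"] d(2)[of h] True by auto
  next
    case False
    then show ?thesis using that[of s] start st by auto
  qed
  have cont: "continuous_on {u..t} g"
  proof (rule DERIV_atLeastAtMost_imp_continuous_on)
    show "\<exists>y. (g has_real_derivative y) (at x)" if "u \<le> x" "x \<le> t" for x
      using der[of x] u(1) that by (intro exI[of _ "g' x"]) auto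
  qed
  have "closed (g -` {0} \<inter> {u..t})"
    using cont by (simp add: continuous_on_closed_vimage)
  then have "compact ({u..t} \<inter> (g -` {0} \<inter> {u..t}))"
    by (intro compact_Int_closed) auto
  moreover have "{u..t} \<inter> (g -` {0} \<inter> {u..t}) \<noteq> {}"
    using IVT2'[of g t 0 u] u gt cont by auto
  ultimately obtain z where z: "z \<in> {u..t}" "g z = 0"
    and first: "\<And>x. x \<in> {u..t} \<Longrightarrow> g x = 0 \<Longrightarrow> z \<le> x"
    using compact_attains_inf[of "{u..t} \<inter> (g -` {0} \<inter> {u..t})"] by blast
  \<comment> \<open>At its first zero \<open>z\<close> after \<open>u\<close>, \<open>g\<close> increases, so it is negative just before \<open>z\<close> and has
    an even earlier zero.\<close>
  have "u < z" using z u(3) by (cases "u = z") auto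
  obtain d where d: "d > 0" "\<And>h. h > 0 \<Longrightarrow> h < d \<Longrightarrow> g (z - h) < g z"
    using DERIV_pos_inc_left[OF der[of z] up[of z]] z u(1) by auto
  define h where "h = min (d / 2) ((z - u) / 2)"
  have h: "h > 0" "h < d" "u < z - h"
    using d(1) \<open>u < z\<close> by (auto simp: h_def min_def field_simps)
  have "continuous_on {u..z - h} g"
    using h z by (intro continuous_on_subset[OF cont]) auto
  then obtain x where "u \<le> x" "x \<le> z - h" "g x = 0"
    using IVT2'[of g "z - h" 0 u] d(2)[OF h(1,2)] h z u(3) by auto
  then show False using first[of x] h z by auto
qed

text \<open>
  A nonpositive value of \<open>H\<close> propagates backwards down to \<open>0\<close> and makes \<open>p\<close> decrease from
  \<open>p (0) = 0\<close>, which contradicts \<open>neg\<close>. Arguing backwards avoids an expansion of \<open>H\<close> near \<open>0\<close>,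
  where the equation is singular.
\<close>

lemma positive_of_upcrossing_sign_condition:
  fixes p p' H H' :: "real \<Rightarrow> real"
  assumes cont: "continuous_on {0..} p" and p0: "p 0 = 0"
    and p': "\<And>x. x > 0 \<Longrightarrow> (p has_real_derivative p' x) (at x)"
    and H': "\<And>x. x > 0 \<Longrightarrow> (H has_real_derivative H' x) (at x)"
    and up: "\<And>x. x > 0 \<Longrightarrow> H x = 0 \<Longrightarrow> H' x > 0"
    and sign: "\<And>x. x > 0 \<Longrightarrow> H x < 0 \<Longrightarrow> p' x < 0"
    and neg: "\<And>x. x > 0 \<Longrightarrow> p x < 0 \<Longrightarrow> H x > 0"
    and r: "r > 0"
  shows "H r > 0"
proof (rule ccontr)
  assume nonpos: "\<not> H r > 0"
  have Hneg: "H x < 0" if "0 < x" "x < r" for x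
  proof (rule ccontr)
    assume "\<not> H x < 0"
    then have "H r > 0"
      using that by (intro upcrossing_stays_positive[of x H H' r] H' up) auto
    with nonpos show False ..
  qed
  have "p (r / 2) < p 0"
  proof (rule DERIV_neg_imp_decreasing_open[of 0 "r / 2" p])
    show "continuous_on {0..r / 2} p" by (rule continuous_on_subset[OF cont]) auto
    show "\<exists>y. (p has_real_derivative y) (at x) \<and> y < 0" if "0 < x" "x < r / 2" for x
      using p'[of x] sign[of x] Hneg[of x] that by (intro exI[of _ "p' x"]) auto
  qed (use r in simp)
  then have "H (r / 2) > 0" using neg[of "r / 2"] r p0 by simp
  then show False using Hneg[of "r / 2"] r by simp
qed

lemma filterlim_at_top_of_strictly_convex:
  fixes f p p' :: "real \<Rightarrow> real"
  assumes f': "\<And>x. x > 0 \<Longrightarrow> (f has_real_derivative p x) (at x)"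
    and p': "\<And>x. x > 0 \<Longrightarrow> (p has_real_derivative p' x) (at x)"
    and pos: "\<And>x. x > 0 \<Longrightarrow> p' x > 0"
    and cont: "continuous_on {0..} p" and p0: "p 0 = 0"
  shows "filterlim f at_top at_top"
proof -
  have "p 0 < p 1"
  proof (rule DERIV_pos_imp_increasing_open[of 0 1 p])
    show "continuous_on {0..1} p" by (rule continuous_on_subset[OF cont]) auto
    show "\<exists>y. (p has_real_derivative y) (at x) \<and> 0 < y" if "0 < x" "x < 1" for x
      using p'[of x] pos[of x] that by (intro exI[of _ "p' x"]) auto
  qed simp
  then have p1: "p 1 > 0" using p0 by simp
  have tangent: "f 1 + p 1 * (x - 1) \<le> f x" if x: "x > 1" for x
  proof -
    obtain z where z: "1 < z" "z < x" "f x - f 1 = (x - 1) * p z"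
      using MVT2[OF x, of f p] f' by force
    have "p 1 \<le> p z"
    proof (rule DERIV_nonneg_imp_nondecreasing[of 1 z p])
      show "\<exists>y. (p has_real_derivative y) (at v) \<and> 0 \<le> y" if "1 \<le> v" "v \<le> z" for v
        using p'[of v] pos[of v] that by (intro exI[of _ "p' v"]) auto
    qed (use z in simp)
    then have "(x - 1) * p 1 \<le> (x - 1) * p z"
      using x by (intro mult_left_mono) auto
    then show ?thesis using z(3) by (simp add: mult.commute)
  qed
  have "filterlim (\<lambda>x. f 1 + p 1 * (x - 1)) at_top at_top"
  proof (intro filterlim_tendsto_add_at_top[OF tendsto_const]
      filterlim_tendsto_pos_mult_at_top[OF tendsto_const p1])
    show "filterlim (\<lambda>x::real. x - 1) at_top at_top"
      using filterlim_tendsto_add_at_top[OF tendsto_const[of "-1"] filterlim_ident[of at_top]]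
      by simp
  qed
  then show ?thesis
    using eventually_mono[OF eventually_gt_at_top[of 1] tangent]
    by (rule filterlim_at_top_mono)
qed

theorem corollary3p1:
  fixes n :: nat and lam mu :: real and f f\<^sub>r f\<^sub>r\<^sub>r :: "real \<Rightarrow> real"
  assumes "n \<ge> 2" and "lam > 1 / (real n - 1)" and "mu < 0"
    and "\<forall>r\<ge>0. (f has_real_derivative f\<^sub>r r) (at r within {0..})"
    and "continuous_on {0..} f\<^sub>r"
    and "\<forall>r>0. (f\<^sub>r has_real_derivative f\<^sub>r\<^sub>r r) (at r)"
    and "continuous_on {0<..} f\<^sub>r\<^sub>r"
    and "\<forall>r>0. f\<^sub>r\<^sub>r r + (real n - 1) / r * (1 + (f\<^sub>r r)\<^sup>2) * f\<^sub>r r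
                 - 1 / lam * ((1 + (f\<^sub>r r)\<^sup>2)\<^sup>2 / (r * f\<^sub>r r - f r)) = 0"
    and "f 0 = mu" and "f\<^sub>r 0 = 0"
    and "\<forall>r\<ge>0. r * f\<^sub>r r > f r"
  shows "(\<forall>r>0. f\<^sub>r\<^sub>r r > 0) \<and> filterlim f at_top at_top"
proof -
  have N: "real n - 1 > 0" using assms(1) by simp
  have lam: "lam > 0"
    using assms(2) N by (meson divide_pos_pos less_trans zero_less_one)
  define c where "c = lam * (real n - 1)"
  have c: "c > 0" using N lam by (simp add: c_def)
  have f': "(f has_real_derivative f\<^sub>r x) (at x)" if "x > 0" for x
  proof -
    have "(f has_real_derivative f\<^sub>r x) (at x within {0<..})"
      using assms(4) that
      by (auto intro!: has_field_derivative_subset[of f "f\<^sub>r x" x "{0..}" "{0<..}"])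
    then show ?thesis using that at_within_open[of x "{0<..}"] by simp
  qed
  have p': "(f\<^sub>r has_real_derivative f\<^sub>r\<^sub>r x) (at x)" if "x > 0" for x
    using assms(6) that by blast
  define w where "w x = x * f\<^sub>r x - f x" for x
  have w: "w x > 0" if "x > 0" for x using assms(11) that by (simp add: w_def)
  have w': "(w has_real_derivative x * f\<^sub>r\<^sub>r x) (at x)" if "x > 0" for x
    unfolding w_def by (auto intro!: derivative_eq_intros f' p' that)
  define H where "H x = x * (1 + (f\<^sub>r x)\<^sup>2) - c * f\<^sub>r x * w x" for x
  define H' where "H' x = 1 + (f\<^sub>r x)\<^sup>2
    + f\<^sub>r\<^sub>r x * (2 * x * f\<^sub>r x - c * w x - c * f\<^sub>r x * x)" for x
  have H_deriv: "(H has_real_derivative H' x) (at x)" if "x > 0" for x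
    unfolding H_def H'_def
    by (rule derivative_eq_intros p' w' that refl)+ (simp add: algebra_simps)
  have factor: "f\<^sub>r\<^sub>r x = (1 + (f\<^sub>r x)\<^sup>2) / (lam * x * w x) * H x" if "x > 0" for x
  proof -
    have "f\<^sub>r\<^sub>r x = 1 / lam * ((1 + (f\<^sub>r x)\<^sup>2)\<^sup>2 / w x)
        - (real n - 1) / x * (1 + (f\<^sub>r x)\<^sup>2) * f\<^sub>r x"
      using assms(8) that by (simp add: w_def algebra_simps)
    also have "\<dots> = (1 + (f\<^sub>r x)\<^sup>2) / (lam * x * w x) * H x"
      using w[OF that] lam that
      by (simp add: H_def c_def divide_simps) (simp add: algebra_simps power2_eq_square)
    finally show ?thesis .
  qed
  have coeff: "(1 + (f\<^sub>r x)\<^sup>2) / (lam * x * w x) > 0" if "x > 0" for x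
    using w[OF that] lam that by (intro divide_pos_pos mult_pos_pos) (auto simp: add_pos_nonneg)
  have H_pos: "H x > 0" if "x > 0" for x
  proof (rule positive_of_upcrossing_sign_condition[OF assms(5) assms(10) p' H_deriv _ _ _ that])
    show "H' y > 0" if "y > 0" "H y = 0" for y
      using factor[OF that(1)] that(2) by (simp add: H'_def add_pos_nonneg)
    show "f\<^sub>r\<^sub>r y < 0" if "y > 0" "H y < 0" for y
      using factor[OF that(1)] mult_pos_neg[OF coeff[OF that(1)] that(2)] by simp
    show "H y > 0" if "y > 0" "f\<^sub>r y < 0" for y
    proof -
      have "c * f\<^sub>r y * w y < 0"
        using c w[OF that(1)] that(2) by (simp add: mult_pos_neg mult_neg_pos)
      moreover have "y * (1 + (f\<^sub>r y)\<^sup>2) > 0"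
        using that(1) by (simp add: add_pos_nonneg)
      ultimately show ?thesis by (simp add: H_def)
    qed
  qed
  have convex: "f\<^sub>r\<^sub>r x > 0" if "x > 0" for x
    using factor[OF that] mult_pos_pos[OF coeff[OF that] H_pos[OF that]] by simp
  show ?thesis
    using convex filterlim_at_top_of_strictly_convex[OF f' p' convex assms(5) assms(10)] by blast
qed

end
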